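(* Let $(T,\Sigma,\mu)$ be a complete nonatomic finite measure space, let $E$ be an infinite-dimensional separable real Banach space with norm dual $E^*$, and let $X$ be an uncountable compact Polish space. Consider quartets $(\varphi,\Phi,U,C)$, with $C$ a weakly$^*$ closed subset of $E^*$, satisfying: (i) $\varphi:T\times X\to\mathbb{R}$ is an integrably bounded Carath\'eodory function; (ii) $\Phi:T\times X\to E^*$ is an integrably bounded measurable function such that $\Phi(t,\cdot):X\to E^*$ is continuous in the weak$^*$ topology of $E^*$ for every $t\in T$; (iii) $U:T\twoheadrightarrow X$ is a closed-valued multifunction with $\mathrm{gph}\,U\in\Sigma\otimes\mathrm{Borel}(X)$; (iv) $\left\{\int_T\int_X\Phi(t,x)\,dP\,d\mu : P\in\Pi(X)\right\}\cap C$ is nonempty; and such that the infimum of $\int_T\int_X\varphi(t,x)\lambda(t,dx)d\mu$ over all $\lambda\in\mathcal{R}(T,X)$ with $\int_T\int_X\Phi(t,x)\lambda(t,dx)d\mu\in C$ and $\lambda(t)(U(t))=1$ a.e. $t\in T$ is less than $+\infty$ (with $\inf\emptyset=+\infty$). If for every such quartet the variational problem $$\min_{f\in\mathcal{M}(T,X)}\int_T\varphi(t,f(t))\,d\mu\quad\text{s.t. }\int_T\Phi(t,f(t))\,d\mu\in C\ \text{ and }\ f(t)\in U(t)\text{ a.e. }t\in T$$ has a solution (a feasible $f\in\mathcal{M}(T,X)$ attaining the minimum), then $(T,\Sigma,\mu)$ is saturated.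
   Context: A finite measure space $(T,\Sigma,\mu)$ is saturated if for every $S\in\Sigma$ with $\mu(S)>0$ the space $L^1_S(\mu)$ of $\mu$-integrable functions on $(S,\Sigma_S)$, $\Sigma_S=\{A\cap S: A\in\Sigma\}$, is nonseparable. $\Pi(X)$ is the set of Borel probability measures on $X$ with the topology of weak convergence (the coarsest topology making $P\mapsto\int u\,dP$ continuous for every bounded continuous $u:X\to\mathbb{R}$) and its Borel $\sigma$-algebra. $\mathcal{M}(T,X)$ is the set of measurable functions $T\to X$; $\mathcal{R}(T,X)$ is the set of measurable functions $\lambda:T\to\Pi(X)$ (relaxed controls), and $\lambda(t,dx)$ denotes integration with respect to $\lambda(t)$. A multifunction is a set-valued map with nonempty values, and $\mathrm{gph}\,U=\{(t,x): x\in U(t)\}$. $\varphi:T\times X\to\mathbb{R}$ is a Carath\'eodory function if $\varphi(\cdot,x)$ is measurable for every $x\in X$ and $\varphi(t,\cdot)$ is continuous for every $t\in T$. A function on $T\times X$ with values in $\mathbb{R}$ or $E^*$ is integrably bounded if its norm at $(t,x)$ is at most $\psi(t)$ for all $(t,x)\in T\times X$, for some $\psi\in L^1(\mu)$. Measurability of $\Phi$ is with respect to $\Sigma\otimes\mathrm{Borel}(X)$ and the Borel $\sigma$-algebra of the weak$^*$ topology of $E^*$. All integrals of $E^*$-valued functions are Gelfand integrals: $\int g\,d\nu\in E^*$ is the element with $\langle\int g\,d\nu,y\rangle=\int\langle g,y\rangle d\nu$ for every $y\in E$. *)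

theory Defs
  imports "HOL-Probability.Probability"
begin

definition nonatomic :: "'a measure \<Rightarrow> bool" where
  "nonatomic M \<longleftrightarrow>
     (\<forall>A\<in>sets M. emeasure M A > 0 \<longrightarrow>
        (\<exists>B\<in>sets M. B \<subseteq> A \<and> 0 < emeasure M B \<and> emeasure M B < emeasure M A))"

text \<open>The points of this space are integrable functions rather than their a.e.-equality
  classes, so it is the topology of a seminorm. The quotient map onto the normed
  space \<open>L\<^sup>1\<close> induces a bijection on open sets, so separability means the same for both.\<close>

definition L1_topology :: "'a measure \<Rightarrow> ('a \<Rightarrow> real) topology" where
  "L1_topology M = topology_generated_by
     {{g. integrable M g \<and> (LINT x|M. \<bar>g x - f x\<bar>) < r} | f r. integrable M f}"

definition saturated :: "'a measure \<Rightarrow> bool" where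
  "saturated M \<longleftrightarrow>
     (\<forall>S\<in>sets M. emeasure M S > 0 \<longrightarrow> \<not> separable_space (L1_topology (restrict_space M S)))"

definition borel_of :: "'a topology \<Rightarrow> 'a measure" where
  "borel_of X = sigma (topspace X) {U. openin X U}"

definition borel_probs :: "'a::topological_space measure set" where
  "borel_probs = {P. prob_space P \<and> sets P = sets borel}"

definition weak_convergence_topology :: "'a::topological_space measure topology" where
  "weak_convergence_topology = topology_generated_by
     {{P \<in> borel_probs. (LINT x|P. u x) \<in> V} | (u :: 'a \<Rightarrow> real) V.
        continuous_on UNIV u \<and> bounded (range u) \<and> open V}"

lemma topspace_weak_convergence_topology:
  "topspace (weak_convergence_topology :: 'a::topological_space measure topology) = borel_probs"
proof -
  have "\<exists>(u :: 'a \<Rightarrow> real) V. borel_probs = {P \<in> borel_probs. (LINT x|P. u x) \<in> V} \<and>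
      continuous_on UNIV u \<and> bounded (range u) \<and> open V"
    by (rule exI[of _ "\<lambda>_. 0"], rule exI[of _ UNIV]) auto
  then show ?thesis
    unfolding weak_convergence_topology_def topology_generated_by_topspace by blast
qed

definition relaxed_controls :: "'t measure \<Rightarrow> ('t \<Rightarrow> 'x::topological_space measure) set" where
  "relaxed_controls M = measurable M (borel_of weak_convergence_topology)"

text \<open>On \<open>E\<^sup>*\<close>, i.e. for operators into the scalars, the strong operator topology, which is the
  topology of pointwise convergence, is the weak-star topology.\<close>

definition weak_star_topology :: "('e::real_normed_vector \<Rightarrow>\<^sub>L real) topology" where
  "weak_star_topology = strong_operator_topology"

definition has_gelfand_integral ::
  "'a measure \<Rightarrow> ('a \<Rightarrow> ('e::real_normed_vector \<Rightarrow>\<^sub>L real)) \<Rightarrow> ('e \<Rightarrow>\<^sub>L real) \<Rightarrow> bool" where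
  "has_gelfand_integral N g z \<longleftrightarrow>
     (\<forall>y. integrable N (\<lambda>w. blinfun_apply (g w) y) \<and>
          blinfun_apply z y = (LINT w|N. blinfun_apply (g w) y))"

lemma has_gelfand_integral_unique:
  "has_gelfand_integral N g z \<Longrightarrow> has_gelfand_integral N g z' \<Longrightarrow> z = z'"
  by (auto simp: has_gelfand_integral_def intro: blinfun_eqI)

text \<open>The description below is meaningful for all integrands of the control problem, by
  \<open>has_gelfand_integral_gelfand_integral\<close>: they are weak-star measurable and bounded in norm by an
  integrable function.\<close>

definition gelfand_integral ::
  "'a measure \<Rightarrow> ('a \<Rightarrow> ('e::real_normed_vector \<Rightarrow>\<^sub>L real)) \<Rightarrow> ('e \<Rightarrow>\<^sub>L real)" where
  "gelfand_integral N g = (THE z. has_gelfand_integral N g z)"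

lemma gelfand_integral_eq:
  "has_gelfand_integral N g z \<Longrightarrow> gelfand_integral N g = z"
  unfolding gelfand_integral_def by (blast intro: has_gelfand_integral_unique)

lemma has_gelfand_integral_gelfand_integral:
  fixes g :: "'a \<Rightarrow> ('e::real_normed_vector \<Rightarrow>\<^sub>L real)"
  assumes meas: "\<And>y. (\<lambda>w. blinfun_apply (g w) y) \<in> borel_measurable N"
    and psi: "integrable N \<psi>" and bound: "\<And>w. w \<in> space N \<Longrightarrow> norm (g w) \<le> \<psi> w"
  shows "has_gelfand_integral N g (gelfand_integral N g)"
proof -
  have le: "norm (blinfun_apply (g w) y) \<le> \<psi> w * norm y" if "w \<in> space N" for w y
    using norm_blinfun[of "g w" y] mult_right_mono[OF bound[OF that] norm_ge_zero[of y]]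
    by linarith
  have int: "integrable N (\<lambda>w. blinfun_apply (g w) y)" for y
  proof (rule Bochner_Integration.integrable_bound)
    show "integrable N (\<lambda>w. \<psi> w * norm y)" using psi by simp
    show "AE w in N. norm (blinfun_apply (g w) y) \<le> norm (\<psi> w * norm y)"
      by (rule AE_I2) (use le in \<open>fastforce intro: order_trans\<close>)
  qed (rule meas)
  have "bounded_linear (\<lambda>y. LINT w|N. blinfun_apply (g w) y)"
  proof (rule bounded_linear_intro[where K = "LINT w|N. \<psi> w"])
    fix y
    have "norm (LINT w|N. blinfun_apply (g w) y) \<le> (LINT w|N. norm (blinfun_apply (g w) y))"
      by (rule integral_norm_bound)
    also have "\<dots> \<le> (LINT w|N. \<psi> w * norm y)"
      by (rule integral_mono) (use int psi le in auto)
    finally show "norm (LINT w|N. blinfun_apply (g w) y) \<le> norm y * (LINT w|N. \<psi> w)"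
      by (simp add: mult.commute)
  qed (simp_all add: blinfun.add_right blinfun.scaleR_right int)
  then have "has_gelfand_integral N g (Blinfun (\<lambda>y. LINT w|N. blinfun_apply (g w) y))"
    by (simp add: has_gelfand_integral_def int bounded_linear_Blinfun_apply)
  then show ?thesis
    by (simp add: gelfand_integral_eq)
qed

definition caratheodory :: "'t measure \<Rightarrow> ('t \<Rightarrow> 'x::topological_space \<Rightarrow> real) \<Rightarrow> bool" where
  "caratheodory M \<phi> \<longleftrightarrow>
     (\<forall>x. (\<lambda>t. \<phi> t x) \<in> borel_measurable M) \<and> (\<forall>t\<in>space M. continuous_on UNIV (\<phi> t))"

definition integrably_bounded ::
  "'t measure \<Rightarrow> ('t \<Rightarrow> 'x \<Rightarrow> 'b::real_normed_vector) \<Rightarrow> bool" where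
  "integrably_bounded M F \<longleftrightarrow>
     (\<exists>\<psi>. integrable M \<psi> \<and> (\<forall>t\<in>space M. \<forall>x. norm (F t x) \<le> \<psi> t))"

definition gph :: "'t measure \<Rightarrow> ('t \<Rightarrow> 'x set) \<Rightarrow> ('t \<times> 'x) set" where
  "gph M U = {(t, x). t \<in> space M \<and> x \<in> U t}"

definition relaxed_constraint_value ::
  "'t measure \<Rightarrow> ('t \<Rightarrow> 'x \<Rightarrow> ('e::real_normed_vector \<Rightarrow>\<^sub>L real)) \<Rightarrow> ('t \<Rightarrow> 'x measure) \<Rightarrow> ('e \<Rightarrow>\<^sub>L real)"
  where
  "relaxed_constraint_value M \<Phi> l =
     gelfand_integral M (\<lambda>t. gelfand_integral (l t) (\<Phi> t))"

definition relaxed_feasible ::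
  "'t measure \<Rightarrow> ('t \<Rightarrow> 'x::topological_space \<Rightarrow> ('e::real_normed_vector \<Rightarrow>\<^sub>L real)) \<Rightarrow>
   ('t \<Rightarrow> 'x set) \<Rightarrow> ('e \<Rightarrow>\<^sub>L real) set \<Rightarrow> ('t \<Rightarrow> 'x measure) set" where
  "relaxed_feasible M \<Phi> U C =
     {l \<in> relaxed_controls M. relaxed_constraint_value M \<Phi> l \<in> C \<and>
        (AE t in M. measure (l t) (U t) = 1)}"

text \<open>In \<open>ereal\<close> the infimum over the empty set is \<open>\<infinity>\<close>.\<close>

definition relaxed_infimum ::
  "'t measure \<Rightarrow> ('t \<Rightarrow> 'x::topological_space \<Rightarrow> real) \<Rightarrow>
   ('t \<Rightarrow> 'x \<Rightarrow> ('e::real_normed_vector \<Rightarrow>\<^sub>L real)) \<Rightarrow>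
   ('t \<Rightarrow> 'x set) \<Rightarrow> ('e \<Rightarrow>\<^sub>L real) set \<Rightarrow> ereal" where
  "relaxed_infimum M \<phi> \<Phi> U C =
     (INF l\<in>relaxed_feasible M \<Phi> U C. ereal (LINT t|M. LINT x|l t. \<phi> t x))"

definition admissible_quartet ::
  "'t measure \<Rightarrow> ('t \<Rightarrow> 'x::topological_space \<Rightarrow> real) \<Rightarrow>
   ('t \<Rightarrow> 'x \<Rightarrow> ('e::real_normed_vector \<Rightarrow>\<^sub>L real)) \<Rightarrow>
   ('t \<Rightarrow> 'x set) \<Rightarrow> ('e \<Rightarrow>\<^sub>L real) set \<Rightarrow> bool" where
  "admissible_quartet M \<phi> \<Phi> U C \<longleftrightarrow>
     closedin weak_star_topology C \<and>
     integrably_bounded M \<phi> \<and> caratheodory M \<phi> \<and>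
     integrably_bounded M \<Phi> \<and>
     case_prod \<Phi> \<in> measurable (M \<Otimes>\<^sub>M borel) (borel_of weak_star_topology) \<and>
     (\<forall>t\<in>space M. continuous_map euclidean weak_star_topology (\<Phi> t)) \<and>
     (\<forall>t\<in>space M. U t \<noteq> {} \<and> closed (U t)) \<and>
     gph M U \<in> sets (M \<Otimes>\<^sub>M borel) \<and>
     {relaxed_constraint_value M \<Phi> (\<lambda>t. P) | P. P \<in> borel_probs} \<inter> C \<noteq> {} \<and>
     relaxed_infimum M \<phi> \<Phi> U C < \<infinity>"

definition feasible ::
  "'t measure \<Rightarrow> ('t \<Rightarrow> 'x::topological_space \<Rightarrow> ('e::real_normed_vector \<Rightarrow>\<^sub>L real)) \<Rightarrow>
   ('t \<Rightarrow> 'x set) \<Rightarrow> ('e \<Rightarrow>\<^sub>L real) set \<Rightarrow> ('t \<Rightarrow> 'x) \<Rightarrow> bool" where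
  "feasible M \<Phi> U C f \<longleftrightarrow>
     f \<in> borel_measurable M \<and> gelfand_integral M (\<lambda>t. \<Phi> t (f t)) \<in> C \<and> (AE t in M. f t \<in> U t)"

definition has_solution ::
  "'t measure \<Rightarrow> ('t \<Rightarrow> 'x::topological_space \<Rightarrow> real) \<Rightarrow>
   ('t \<Rightarrow> 'x \<Rightarrow> ('e::real_normed_vector \<Rightarrow>\<^sub>L real)) \<Rightarrow>
   ('t \<Rightarrow> 'x set) \<Rightarrow> ('e \<Rightarrow>\<^sub>L real) set \<Rightarrow> bool" where
  "has_solution M \<phi> \<Phi> U C \<longleftrightarrow>
     (\<exists>f. is_arg_min (\<lambda>f. LINT t|M. \<phi> t (f t)) (feasible M \<Phi> U C) f)"

end

theory Submission
  imports Defs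
begin

text \<open>If \<open>L\<^sup>1\<close> over some set \<open>S\<close> of positive measure is separable, with dense sequence \<open>d\<close>, let \<open>a \<noteq> b\<close>
  be points of \<open>X\<close>, let \<open>h\<close> be continuous with values in \<open>[-1, 1]\<close>, \<open>h a = -1\<close> and \<open>h b = 1\<close>, and let
  \<open>\<Phi> t x\<close> be the series of the \<open>2\<^sup>-\<^sup>n \<tau> (h x * 1\<^sub>S t * d n t) F n\<close>, where \<open>\<tau>\<close> truncates to \<open>[-1, 1]\<close>
  and the functionals \<open>F n\<close> are so independent that a vanishing series has vanishing coefficients.
  With \<open>U t = {a, b}\<close> and \<open>C = {0}\<close>, the even mixture of \<open>a\<close> and \<open>b\<close> is a feasible relaxed control.
  For a feasible ordinary control \<open>f\<close>, however, the sign \<open>h \<circ> f\<close> would satisfy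
  \<open>\<integral>\<^sub>S (h \<circ> f) * \<tau> (d n) = 0\<close> for all \<open>n\<close>, although some \<open>\<tau> (d n)\<close> is closer to \<open>h \<circ> f\<close> than \<open>\<mu> S\<close>
  in \<open>L\<^sup>1\<close>. So the minimization problem is infeasible, whatever its objective.\<close>

subsection \<open>Separation by continuous functionals\<close>

text \<open>Homogeneity is asked only as an inequality, which is easy to verify for infima; using it
  with \<open>inverse c\<close> as well gives equality for \<open>c > 0\<close>.\<close>

definition sublinear :: "('a::real_vector \<Rightarrow> real) \<Rightarrow> bool" where
  "sublinear p \<longleftrightarrow> (\<forall>x y. p (x + y) \<le> p x + p y) \<and> (\<forall>c\<ge>0. \<forall>x. p (c *\<^sub>R x) \<le> c * p x)"

lemma sublinearD:
  assumes "sublinear p"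
  shows "p (x + y) \<le> p x + p y" "c \<ge> 0 \<Longrightarrow> p (c *\<^sub>R x) = c * p x" "p 0 = 0" "- p (- x) \<le> p x"
proof -
  have add: "p (x + y) \<le> p x + p y" for x y
    using assms by (auto simp: sublinear_def)
  have le: "p (c *\<^sub>R x) \<le> c * p x" if "c \<ge> 0" for c x
    using assms that by (auto simp: sublinear_def)
  show zero: "p 0 = 0"
    using add[of 0 0] le[of 0 0] by simp
  show "p (c *\<^sub>R x) = c * p x" if "c \<ge> 0"
  proof (cases "c = 0")
    case False
    have "p (inverse c *\<^sub>R (c *\<^sub>R x)) \<le> inverse c * p (c *\<^sub>R x)"
      using that by (intro le) simp
    then have "c * p x \<le> p (c *\<^sub>R x)"
      using that False by (simp add: field_simps)
    then show ?thesis
      using le[OF that, of x] by simp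
  qed (simp add: zero)
  show "- p (- x) \<le> p x"
    using add[of x "- x"] zero by simp
qed (use assms in \<open>auto simp: sublinear_def\<close>)

text \<open>One Hahn-Banach step without extending domains: the infimum of
  \<open>q (x + t *\<^sub>R y) - t * q y\<close> over \<open>t \<ge> 0\<close> lowers
  \<open>q\<close> just until it is odd in the direction \<open>y\<close>. The values
  \<open>t = 0\<close> and \<open>t = 1\<close> give the two bounds.\<close>

lemma sublinear_descend:
  assumes q: "sublinear q"
  obtains r where "sublinear r" "\<And>x. r x \<le> q x" "r (- y) \<le> - q y"
proof -
  define r where "r x = (INF t\<in>{0..}. q (x + t *\<^sub>R y) - t * q y)" for x
  have bdd: "bdd_below ((\<lambda>t. q (x + t *\<^sub>R y) - t * q y) ` {0..})" for x
  proof (rule bdd_belowI2[where m = "- q (- x)"])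
    fix t :: real
    assume "t \<in> {0..}"
    then show "- q (- x) \<le> q (x + t *\<^sub>R y) - t * q y"
      using sublinearD(1)[OF q, of "x + t *\<^sub>R y" "- x"] sublinearD(2)[OF q, of t y] by simp
  qed
  have low: "r x \<le> q (x + t *\<^sub>R y) - t * q y" if "t \<ge> 0" for x t
    unfolding r_def using that by (intro cINF_lower[OF bdd]) simp
  have great: "m \<le> r x" if "\<And>t. t \<ge> 0 \<Longrightarrow> m \<le> q (x + t *\<^sub>R y) - t * q y" for m x
    unfolding r_def using that by (intro cINF_greatest) auto
  have add: "r (x + z) \<le> r x + r z" for x z
  proof -
    have "r (x + z) - (q (x + t *\<^sub>R y) - t * q y) \<le> r z" if t: "t \<ge> 0" for t
    proof (rule great)
      fix s :: real
      assume s: "s \<ge> 0"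
      have "r (x + z) \<le> q ((x + z) + (t + s) *\<^sub>R y) - (t + s) * q y"
        using s t by (intro low) simp
      moreover have "q ((x + z) + (t + s) *\<^sub>R y) \<le> q (x + t *\<^sub>R y) + q (z + s *\<^sub>R y)"
        using sublinearD(1)[OF q, of "x + t *\<^sub>R y" "z + s *\<^sub>R y"] by (simp add: algebra_simps)
      ultimately show "r (x + z) - (q (x + t *\<^sub>R y) - t * q y) \<le> q (z + s *\<^sub>R y) - s * q y"
        by (simp add: algebra_simps)
    qed
    then have "r (x + z) - r z \<le> r x"
      by (intro great) (simp add: algebra_simps)
    then show ?thesis by simp
  qed
  have scale: "r (c *\<^sub>R x) \<le> c * r x" if c: "c \<ge> 0" for c x
  proof (cases "c = 0")
    case True
    then show ?thesis using low[of 0 0] sublinearD(3)[OF q] by simp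
  next
    case False
    have "r (c *\<^sub>R x) / c \<le> r x"
    proof (rule great)
      fix t :: real
      assume t: "t \<ge> 0"
      have "r (c *\<^sub>R x) \<le> q (c *\<^sub>R x + (c * t) *\<^sub>R y) - (c * t) * q y"
        using c t by (intro low) simp
      also have "\<dots> = c * (q (x + t *\<^sub>R y) - t * q y)"
        using sublinearD(2)[OF q c, of "x + t *\<^sub>R y"] by (simp add: algebra_simps)
      finally show "r (c *\<^sub>R x) / c \<le> q (x + t *\<^sub>R y) - t * q y"
        using c False by (simp add: field_simps)
    qed
    then show ?thesis using c False by (simp add: field_simps)
  qed
  have "sublinear r"
    using add scale by (simp add: sublinear_def)
  moreover have "r x \<le> q x" for x
    using low[of 0 x] by simp
  moreover have "r (- y) \<le> - q y"
    using low[of 1 "- y"] sublinearD(3)[OF q] by simp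
  ultimately show ?thesis
    using that by blast
qed

text \<open>Bounds chains from below for Zorn's lemma. Subadditivity of the infimum rests on the
  chain condition: the smaller of \<open>q\<close> and \<open>r\<close> serves at both points. The
  majorant \<open>p\<close> bounds the infimum below by \<open>- p (- x)\<close>.\<close>

lemma sublinear_chain_Inf:
  fixes p :: "'a::real_vector \<Rightarrow> real"
  assumes p: "\<And>q x. q \<in> C \<Longrightarrow> q x \<le> p x" and C: "\<And>q. q \<in> C \<Longrightarrow> sublinear q" "C \<noteq> {}"
    and chain: "\<And>q r. q \<in> C \<Longrightarrow> r \<in> C \<Longrightarrow> q \<le> r \<or> r \<le> q"
  shows "sublinear (\<lambda>x. INF q\<in>C. q x)" and "q \<in> C \<Longrightarrow> (INF q\<in>C. q x) \<le> q x"
proof -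
  define u where "u x = (INF q\<in>C. q x)" for x
  have bdd: "bdd_below ((\<lambda>q. q x) ` C)" for x
  proof (rule bdd_belowI2[where m = "- p (- x)"])
    fix q
    assume "q \<in> C"
    then show "- p (- x) \<le> q x"
      using p[of q "- x"] sublinearD(4)[OF C(1), of q x] by linarith
  qed
  have low: "u x \<le> q x" if "q \<in> C" for q x
    unfolding u_def using that by (intro cINF_lower[OF bdd])
  then show "(INF q\<in>C. q x) \<le> q x" if "q \<in> C"
    using that by (simp add: u_def)
  have great: "m \<le> u x" if "\<And>q. q \<in> C \<Longrightarrow> m \<le> q x" for m x
    unfolding u_def using that C(2) by (intro cINF_greatest) auto
  have add: "u (x + y) \<le> u x + u y" for x y
  proof -
    have "u (x + y) - q x \<le> u y" if q: "q \<in> C" for q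
    proof (rule great)
      fix r
      assume r: "r \<in> C"
      show "u (x + y) - q x \<le> r y"
        using chain[OF q r] low[OF q, of "x + y"] low[OF r, of "x + y"]
          sublinearD(1)[OF C(1)[OF q], of x y] sublinearD(1)[OF C(1)[OF r], of x y]
        by (force simp: le_fun_def intro: order_trans dest: spec[of _ x] spec[of _ y])
    qed
    then have "u (x + y) - u y \<le> u x"
      by (intro great) (simp add: algebra_simps)
    then show ?thesis by simp
  qed
  have scale: "u (c *\<^sub>R x) \<le> c * u x" if c: "c \<ge> 0" for c x
  proof (cases "c = 0")
    case True
    obtain q where q: "q \<in> C" using C(2) by auto
    show ?thesis using True low[OF q, of 0] sublinearD(3)[OF C(1)[OF q]] by simp
  next
    case False
    have "u (c *\<^sub>R x) / c \<le> u x"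
    proof (rule great)
      fix q
      assume "q \<in> C"
      then show "u (c *\<^sub>R x) / c \<le> q x"
        using c False low[of q "c *\<^sub>R x"] sublinearD(2)[OF C(1) c, of q x]
        by (simp add: field_simps)
    qed
    then show ?thesis using c False by (simp add: field_simps)
  qed
  show "sublinear (\<lambda>x. INF q\<in>C. q x)"
    using add scale by (simp add: sublinear_def u_def)
qed

text \<open>A minimal sublinear functional cannot be lowered by \<open>sublinear_descend\<close>, hence is odd.\<close>

lemma linear_below_sublinear:
  fixes p :: "'a::real_vector \<Rightarrow> real"
  assumes "sublinear p"
  obtains f where "linear f" "\<And>x. f x \<le> p x" "f v = p v"
proof -
  \<comment> \<open>Descending at \<open>v\<close> first fixes the value there: a linear
    \<open>f\<close> below \<open>r\<close> has \<open>- f v = f (- v) \<le> - p v\<close>, while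
    \<open>f v \<le> p v\<close>.\<close>
  obtain r where r: "sublinear r" "\<And>x. r x \<le> p x" "r (- v) \<le> - p v"
    using sublinear_descend[OF assms] by blast
  define A where "A = {q. sublinear q \<and> q \<le> r}"
  \<comment> \<open>The order is reversed, so Zorn's lemma yields a minimal functional, and the
    bounds of chains are pointwise infima.\<close>
  have "\<exists>f\<in>A. \<forall>q\<in>A. f \<ge> q \<longrightarrow> q = f"
  proof (rule predicate_Zorn)
    show "partial_order_on A (relation_of (\<ge>) A)"
      by (rule partial_order_on_relation_ofI) auto
  next
    fix C
    assume C: "C \<in> Chains (relation_of (\<ge>) A)"
    then have CA: "C \<subseteq> A" by (rule Chains_relation_of)
    have chain: "a \<le> b \<or> b \<le> a" if "a \<in> C" "b \<in> C" for a b
      using C that by (auto simp: Chains_def relation_of_def)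
    show "\<exists>u\<in>A. \<forall>q\<in>C. q \<ge> u"
    proof (cases "C = {}")
      case True
      then show ?thesis using r(1) by (auto simp: A_def)
    next
      case False
      have sub: "sublinear q" "q x \<le> r x" if "q \<in> C" for q x
        using that CA by (auto simp: A_def le_fun_def)
      let ?u = "\<lambda>x. INF q\<in>C. q x"
      have "sublinear ?u"
        by (rule sublinear_chain_Inf(1)[of C r]) (use sub False chain in auto)
      moreover have "?u \<le> q" if "q \<in> C" for q
        by (rule le_funI, rule sublinear_chain_Inf(2)[of C r]) (use sub False chain that in auto)
      ultimately show ?thesis
        using False CA by (intro bexI[of _ ?u]) (auto simp: A_def intro: order_trans)
    qed
  qed
  then obtain f where f: "sublinear f" "f \<le> r" and min: "\<And>q. sublinear q \<Longrightarrow> q \<le> f \<Longrightarrow> q = f"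
    by (auto simp: A_def intro: order_trans)
  have odd: "f (- x) = - f x" for x
  proof -
    obtain q where q: "sublinear q" "\<And>z. q z \<le> f z" "q (- x) \<le> - f x"
      using sublinear_descend[OF f(1)] by blast
    have "q = f"
      using q by (intro min) (auto simp: le_fun_def)
    then show ?thesis
      using q(3) sublinearD(4)[OF f(1), of x] by simp
  qed
  have "linear f"
  proof (rule linearI)
    fix x y
    show "f (x + y) = f x + f y"
      using sublinearD(1)[OF f(1), of x y] sublinearD(1)[OF f(1), of "x + y" "- y"] odd[of y] by simp
  next
    fix c :: real and x
    show "f (c *\<^sub>R x) = c *\<^sub>R f x"
      using sublinearD(2)[OF f(1), of c x] sublinearD(2)[OF f(1), of "- c" x] odd[of "c *\<^sub>R x"]
      by (cases "c \<ge> 0") auto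
  qed
  moreover have le: "f x \<le> p x" for x
    using f(2) r(2)[of x] by (meson le_funD order_trans)
  moreover have "f v = p v"
    using le[of v] r(3) le_funD[OF f(2), of "- v"] odd[of v] by linarith
  ultimately show ?thesis
    using that by blast
qed

text \<open>The distance to \<open>S\<close> is the quotient seminorm: approximants from
  \<open>S\<close> may be added and scaled within \<open>S\<close>. It serves to dominate the
  separating functional.\<close>

lemma sublinear_infdist:
  fixes S :: "'a::real_normed_vector set"
  assumes S: "subspace S"
  shows "sublinear (\<lambda>x. infdist x S)"
proof -
  have ne: "S \<noteq> {}"
    using subspace_0[OF S] by auto
  have great: "m \<le> infdist x S" if "\<And>s. s \<in> S \<Longrightarrow> m \<le> dist x s" for m x
    unfolding infdist_notempty[OF ne] using that ne by (intro cINF_greatest) auto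
  have "infdist (x + y) S \<le> infdist x S + infdist y S" for x y
  proof -
    have "infdist (x + y) S - dist x s \<le> infdist y S" if s: "s \<in> S" for s
    proof (rule great)
      fix s'
      assume "s' \<in> S"
      then have "infdist (x + y) S \<le> dist (x + y) (s + s')"
        using s S by (intro infdist_le subspace_add)
      then show "infdist (x + y) S - dist x s \<le> dist y s'"
        using dist_triangle_add[of x y s s'] by linarith
    qed
    then have "infdist (x + y) S - infdist y S \<le> infdist x S"
      by (intro great) (simp add: algebra_simps)
    then show ?thesis by simp
  qed
  moreover have "infdist (c *\<^sub>R x) S \<le> c * infdist x S" if c: "c \<ge> 0" for c x
  proof (cases "c = 0")
    case True
    then show ?thesis using subspace_0[OF S] by simp
  next
    case False
    have "infdist (c *\<^sub>R x) S / c \<le> infdist x S"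
    proof (rule great)
      fix s
      assume "s \<in> S"
      then have "infdist (c *\<^sub>R x) S \<le> dist (c *\<^sub>R x) (c *\<^sub>R s)"
        using S by (intro infdist_le subspace_scale)
      also have "\<dots> = c * dist x s"
        using c by (simp add: dist_norm flip: scaleR_diff_right)
      finally show "infdist (c *\<^sub>R x) S / c \<le> dist x s"
        using c False by (simp add: field_simps)
    qed
    then show ?thesis using c False by (simp add: field_simps)
  qed
  ultimately show ?thesis
    by (simp add: sublinear_def)
qed

text \<open>Take \<open>f\<close> linear below the distance to \<open>S\<close>, with equality at
  \<open>v\<close>. On \<open>S\<close> both \<open>f x\<close> and \<open>- f x\<close> are at most
  0; \<open>0 \<in> S\<close> gives the norm bound; closedness makes the distance at
  \<open>v\<close> positive.\<close>

lemma separating_functional: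
  fixes S :: "'a::real_normed_vector set"
  assumes S: "subspace S" "closed S" and v: "v \<notin> S"
  obtains F :: "'a \<Rightarrow>\<^sub>L real" where "F v \<noteq> 0" "\<And>x. x \<in> S \<Longrightarrow> F x = 0" "norm F \<le> 1"
proof -
  obtain f where f: "linear f" "\<And>x. f x \<le> infdist x S" "f v = infdist v S"
    using linear_below_sublinear[OF sublinear_infdist[OF S(1)]] by blast
  have abs: "\<bar>f x\<bar> \<le> norm x" for x
    using f(2)[of x] f(2)[of "- x"] linear_neg[OF f(1), of x]
      infdist_le[OF subspace_0[OF S(1)], of x] infdist_le[OF subspace_0[OF S(1)], of "- x"]
    by simp
  have bl: "bounded_linear f"
    using f(1) abs by (intro bounded_linear_intro[where K = 1]) (auto simp: linear_add linear_scale)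
  show ?thesis
  proof
    show "Blinfun f v \<noteq> 0"
      using v f(3) infdist_pos_not_in_closed[OF S(2) _ v] subspace_0[OF S(1)]
      by (force simp: bounded_linear_Blinfun_apply[OF bl])
    show "norm (Blinfun f) \<le> 1"
      using abs by (intro norm_blinfun_bound) (auto simp: bounded_linear_Blinfun_apply[OF bl])
    fix x
    assume x: "x \<in> S"
    then have "infdist x S = 0" "infdist (- x) S = 0"
      using S(1) by (auto simp: subspace_neg)
    then show "Blinfun f x = 0"
      using f(2)[of x] f(2)[of "- x"] linear_neg[OF f(1), of x]
      by (simp add: bounded_linear_Blinfun_apply[OF bl])
  qed
qed

text \<open>If \<open>b\<close> is new, a functional vanishing on \<open>span B\<close> but not at
  \<open>b\<close> reads off the coefficient of \<open>b\<close>. The larger span is then the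
  preimage of \<open>span B\<close> under the continuous map that removes this component.\<close>

lemma closed_span_finite:
  fixes B :: "'a::real_normed_vector set"
  assumes "finite B"
  shows "closed (span B)"
  using assms
proof (induction B)
  case (insert b B)
  show ?case
  proof (cases "b \<in> span B")
    case True
    then show ?thesis using insert by (simp add: span_redundant)
  next
    case False
    obtain F :: "'a \<Rightarrow>\<^sub>L real" where F: "F b \<noteq> 0" "\<And>x. x \<in> span B \<Longrightarrow> F x = 0"
      using separating_functional[OF subspace_span insert.IH False] by metis
    have "span (insert b B) = (\<lambda>x. x - (F x / F b) *\<^sub>R b) -` span B"
    proof (intro set_eqI iffI)
      fix x
      assume "x \<in> span (insert b B)"
      then obtain k where k: "x - k *\<^sub>R b \<in> span B"
        using span_breakdown_eq[of x b B] by auto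
      have "F x = k * F b"
        using F(2)[OF k] by (simp add: blinfun.diff_right blinfun.scaleR_right)
      then show "x \<in> (\<lambda>x. x - (F x / F b) *\<^sub>R b) -` span B"
        using k F(1) by simp
    next
      fix x
      assume "x \<in> (\<lambda>x. x - (F x / F b) *\<^sub>R b) -` span B"
      then show "x \<in> span (insert b B)"
        using span_breakdown_eq[of x b B] by auto
    qed
    then show ?thesis
      using F(1) insert.IH by (auto intro!: continuous_closed_vimage continuous_intros)
  qed
qed simp

text \<open>Choose \<open>Y n\<close> outside the span of its predecessors, which is closed, and
  separate it from that span. The norm bound lets weighted series of the \<open>F n\<close>
  converge.\<close>

lemma triangular_functionals:
  assumes inf: "\<not> (\<exists>B :: 'a::real_normed_vector set. finite B \<and> span B = UNIV)"
  obtains Y :: "nat \<Rightarrow> 'a::real_normed_vector" and F :: "nat \<Rightarrow> 'a \<Rightarrow>\<^sub>L real"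
  where "\<And>n. F n (Y n) \<noteq> 0" "\<And>m n. m < n \<Longrightarrow> F n (Y m) = 0" "\<And>n. norm (F n) \<le> 1"
proof -
  have "\<exists>Y :: nat \<Rightarrow> 'a. \<forall>n. Y n \<notin> span (Y ` {..<n})"
  proof (rule dependent_wellorder_choice)
    fix Y :: "nat \<Rightarrow> 'a" and n
    show "\<exists>y. y \<notin> span (Y ` {..<n})"
      using inf by (metis UNIV_eq_I finite_imageI finite_lessThan)
  \<comment> \<open>The choice principle also asks that the condition at \<open>n\<close> depend
    only on the values of \<open>Y\<close> below \<open>n\<close>.\<close>
  qed (metis (no_types, lifting) image_cong lessThan_iff)
  then obtain Y :: "nat \<Rightarrow> 'a" where Y: "\<And>n. Y n \<notin> span (Y ` {..<n})"
    by blast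
  have "\<exists>G :: 'a \<Rightarrow>\<^sub>L real. blinfun_apply G (Y n) \<noteq> 0 \<and>
      (\<forall>x\<in>span (Y ` {..<n}). blinfun_apply G x = 0) \<and> norm G \<le> 1" for n
    using separating_functional[OF subspace_span closed_span_finite Y]
    by (metis finite_imageI finite_lessThan)
  then obtain F :: "nat \<Rightarrow> 'a \<Rightarrow>\<^sub>L real"
    where F: "\<And>n. F n (Y n) \<noteq> 0" "\<And>n x. x \<in> span (Y ` {..<n}) \<Longrightarrow> F n x = 0" "\<And>n. norm (F n) \<le> 1"
    by metis
  show ?thesis
    by (rule that[OF F(1) F(2) F(3)]) (auto intro: span_base)
qed

subsection \<open>Vector-valued integrands with prescribed coordinates\<close>

text \<open>Integrable functions may be unbounded; truncation makes them bounded coefficients, and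
  it is odd, 1-Lipschitz and the identity on \<open>[-1, 1]\<close>.\<close>

definition truncate :: "real \<Rightarrow> real" where
  "truncate r = max (- 1) (min 1 r)"

lemma abs_truncate_le: "\<bar>truncate r\<bar> \<le> 1"
  by (auto simp: truncate_def)

lemma truncate_minus: "truncate (- r) = - truncate r"
  by (auto simp: truncate_def)

lemma borel_measurable_truncate [measurable]: "truncate \<in> borel_measurable borel"
  unfolding truncate_def by measurable

lemma continuous_on_truncate [continuous_intros]:
  "continuous_on S f \<Longrightarrow> continuous_on S (\<lambda>x. truncate (f x))"
  unfolding truncate_def by (intro continuous_intros)

text \<open>Taken as a function of the whole coefficient sequence, so that continuity in
  \<open>x\<close> and measurability in \<open>(t, x)\<close> both come from continuity on the
  product space of sequences.\<close>

definition weighted_series :: "(nat \<Rightarrow> 'a::banach) \<Rightarrow> (nat \<Rightarrow> real) \<Rightarrow> 'a" where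
  "weighted_series F z = (\<Sum>n. ((1/2) ^ n * truncate (z n)) *\<^sub>R F n)"

context
  fixes F :: "nat \<Rightarrow> 'a::banach"
  assumes F: "\<And>n. norm (F n) \<le> 1"
begin

lemma norm_weighted_term_le: "norm (((1/2) ^ n * truncate (z n)) *\<^sub>R F n) \<le> (1/2) ^ n"
  using mult_mono[OF abs_truncate_le[of "z n"] F[of n]] by (simp add: abs_mult)

lemma summable_weighted_norm: "summable (\<lambda>n. norm (((1/2) ^ n * truncate (z n)) *\<^sub>R F n))"
  by (rule summable_comparison_test'[where g = "\<lambda>n. (1/2) ^ n" and N = 0])
    (use norm_weighted_term_le in auto)

lemma norm_weighted_series_le: "norm (weighted_series F z) \<le> 2"
proof -
  have "norm (weighted_series F z) \<le> (\<Sum>n. norm (((1/2) ^ n * truncate (z n)) *\<^sub>R F n))"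
    unfolding weighted_series_def by (rule summable_norm[OF summable_weighted_norm])
  also have "\<dots> \<le> (\<Sum>n. (1/2) ^ n)"
    by (intro suminf_le norm_weighted_term_le summable_weighted_norm) simp
  also have "\<dots> = 2"
    by (simp add: suminf_geometric)
  finally show ?thesis .
qed

lemma weighted_series_uminus: "weighted_series F (\<lambda>n. - z n) = - weighted_series F z"
  unfolding weighted_series_def
  by (subst suminf_minus[symmetric])
    (auto intro: summable_norm_cancel[OF summable_weighted_norm] simp: truncate_minus)

text \<open>Partial sums involve finitely many coordinates, hence are continuous for the product
  topology; the majorant \<open>(1/2) ^ n\<close> makes their convergence uniform.\<close>

lemma continuous_on_weighted_series: "continuous_on UNIV (weighted_series F)"
proof (rule uniform_limit_theorem)
  show "uniform_limit UNIV (\<lambda>N z. \<Sum>n<N. ((1/2) ^ n * truncate (z n)) *\<^sub>R F n)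
      (weighted_series F) sequentially"
    unfolding weighted_series_def
    by (rule Weierstrass_m_test[OF norm_weighted_term_le]) simp
  show "\<forall>\<^sub>F N in sequentially.
      continuous_on UNIV (\<lambda>z. \<Sum>n<N. ((1/2) ^ n * truncate (z n)) *\<^sub>R F n)"
    by (intro always_eventually allI continuous_intros continuous_on_product_coordinates)
qed simp

text \<open>Factoring through the space of sequences gives norm-Borel measurability even into a
  nonseparable space, as a dual may be.\<close>

lemma weighted_series_measurable:
  assumes "\<And>n. (\<lambda>t. z t n) \<in> borel_measurable M"
  shows "(\<lambda>t. weighted_series F (z t)) \<in> borel_measurable M"
  by (rule measurable_compose[OF measurable_coordinatewise_then_product[OF assms]
        borel_measurable_continuous_onI[OF continuous_on_weighted_series]])

end

lemma blinfun_apply_weighted_series: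
  fixes F :: "nat \<Rightarrow> 'a::real_normed_vector \<Rightarrow>\<^sub>L real"
  assumes "\<And>n. norm (F n) \<le> 1"
  shows "(\<lambda>n. (1/2) ^ n * truncate (z n) * F n y) sums weighted_series F z y"
  using bounded_linear.sums[OF blinfun.bounded_linear_left[of y]
      summable_sums[OF summable_norm_cancel[OF summable_weighted_norm[OF assms, of z]]]]
  by (simp add: weighted_series_def blinfun.scaleR_left)

text \<open>Testing against \<open>Y m\<close> leaves only the terms up to \<open>m\<close> of the series, so that the
  coefficients vanish one after the other.\<close>

lemma gelfand_integral_weighted_series_0D:
  fixes F :: "nat \<Rightarrow> 'a::real_normed_vector \<Rightarrow>\<^sub>L real"
  assumes "finite_measure M" and z: "\<And>n. (\<lambda>t. z t n) \<in> borel_measurable M"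
    and F: "\<And>n. norm (F n) \<le> 1" "\<And>n. F n (Y n) \<noteq> 0" "\<And>m n. m < n \<Longrightarrow> F n (Y m) = 0"
    and zero: "has_gelfand_integral M (\<lambda>t. weighted_series F (z t)) 0"
  shows "(LINT t|M. truncate (z t n)) = 0"
proof -
  interpret finite_measure M by fact
  define c where "c n = (LINT t|M. truncate (z t n))" for n
  note z [measurable]
  have int: "integrable M (\<lambda>t. truncate (z t n))" for n
    by (rule integrable_const_bound[where B = 1]) (auto simp: abs_truncate_le)
  \<comment> \<open>Termwise integration: the majorants \<open>(1/2) ^ n * norm y\<close> have
    summable integrals because the measure is finite.\<close>
  have sums: "(\<lambda>n. (1/2) ^ n * c n * F n y) sums 0" for y
  proof -
    let ?f = "\<lambda>n t. (1/2) ^ n * truncate (z t n) * F n y"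
    have le: "norm (?f n t) \<le> (1/2) ^ n * norm y" for n t
      using mult_mono[OF abs_truncate_le[of "z t n"] norm_blinfun[of "F n" y]]
        mult_right_mono[OF F(1)[of n] norm_ge_zero[of y]]
      by (auto simp: abs_mult intro: order_trans)
    have "(\<lambda>n. LINT t|M. ?f n t) sums (LINT t|M. (\<Sum>n. ?f n t))"
    proof (rule sums_integral)
      have geom: "summable (\<lambda>n. (1/2 :: real) ^ n * r)" for r
        by (intro summable_mult2 summable_geometric) simp
      show "AE t in M. summable (\<lambda>n. norm (?f n t))"
        by (intro AE_I2 summable_norm_comparison_test[OF _ geom[of "norm y"]] exI[of _ 0]
            allI impI le)
      show "summable (\<lambda>n. LINT t|M. norm (?f n t))"
      proof (rule summable_comparison_test'[OF geom])
        fix n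
        have "norm (LINT t|M. norm (?f n t)) = (LINT t|M. norm (?f n t))"
          unfolding real_norm_def by (rule abs_of_nonneg, rule integral_nonneg_AE) simp
        also have "\<dots> \<le> (LINT t|M. (1/2) ^ n * norm y)"
          by (rule integral_mono[OF integrable_norm _ le]) (use int in auto)
        finally show "norm (LINT t|M. norm (?f n t)) \<le> (1/2) ^ n * (norm y * measure M (space M))"
          by (simp add: algebra_simps)
      qed
    qed (use int in auto)
    moreover have "(\<Sum>n. ?f n t) = weighted_series F (z t) y" for t
      by (intro sums_unique[symmetric] blinfun_apply_weighted_series F)
    ultimately show ?thesis
      using zero int by (simp add: has_gelfand_integral_def c_def)
  qed
  have "c n = 0"
  proof (induction n rule: less_induct)
    case (less m)
    have "(\<lambda>n. (1/2) ^ n * c n * F n (Y m)) sums ((1/2) ^ m * c m * F m (Y m))"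
      using F(3) less by (intro sums_single[of m, THEN sums_cong[THEN iffD1, rotated]])
        (auto simp: neq_iff)
    with sums[of "Y m"] show ?case
      using F(2) by (auto dest: sums_unique2)
  qed
  then show ?thesis by (simp add: c_def)
qed

subsection \<open>Separable spaces of integrable functions\<close>

lemma L1_ball_open:
  assumes "integrable M f"
  shows "openin (L1_topology M) {g. integrable M g \<and> (LINT x|M. \<bar>g x - f x\<bar>) < r}"
  unfolding L1_topology_def using assms by (intro topology_generated_by_Basis) blast

lemma separable_L1_dense_sequence:
  fixes M :: "'a measure"
  assumes "separable_space (L1_topology M)"
  obtains d :: "nat \<Rightarrow> 'a \<Rightarrow> real" where "\<And>n. integrable M (d n)"
    "\<And>(w :: 'a \<Rightarrow> real) e. integrable M w \<Longrightarrow> e > 0 \<Longrightarrow> \<exists>n. (LINT x|M. \<bar>d n x - w x\<bar>) < e"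
proof -
  obtain D :: "('a \<Rightarrow> real) set" where D: "countable D"
      "L1_topology M closure_of D = topspace (L1_topology M)"
    using assms by (auto simp: separable_space_def)
  have "\<exists>g\<in>D. integrable M g \<and> (LINT x|M. \<bar>g x - w x\<bar>) < e"
    if w: "integrable M w" and e: "e > 0"
    for w :: "'a \<Rightarrow> real" and e :: real
  proof -
    let ?B = "{g. integrable M g \<and> (LINT x|M. \<bar>g x - w x\<bar>) < e}"
    have "w \<in> ?B" using w e by simp
    then have "w \<in> L1_topology M closure_of D"
      using openin_subset[OF L1_ball_open[OF w]] D(2) by blast
    then have "\<exists>g. g \<in> D \<and> g \<in> ?B"
      using \<open>w \<in> ?B\<close> L1_ball_open[OF w, of e] unfolding in_closure_of by meson
    then show ?thesis by auto
  qed
  note dense = this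
  \<comment> \<open>Every term of the enumeration must be integrable; density near the zero function
    makes \<open>D'\<close> nonempty, as \<open>from_nat_into\<close> requires.\<close>
  define D' where "D' = {g \<in> D. integrable M g}"
  have ne: "D' \<noteq> {}"
    using dense[of "\<lambda>_. 0" 1] by (auto simp: D'_def)
  have range: "range (from_nat_into D') = D'"
    using D(1) ne by (intro range_from_nat_into) (auto simp: D'_def)
  show ?thesis
  proof
    show "integrable M (from_nat_into D' n)" for n
      using from_nat_into[OF ne, of n] by (simp add: D'_def)
    fix w :: "'a \<Rightarrow> real" and e :: real
    assume "integrable M w" "e > 0"
    then obtain g where "g \<in> D'" "(LINT x|M. \<bar>g x - w x\<bar>) < e"
      using dense by (auto simp: D'_def)
    then show "\<exists>n. (LINT x|M. \<bar>from_nat_into D' n x - w x\<bar>) < e"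
      using range by (metis imageE)
  qed
qed

text \<open>Pick \<open>d n\<close> closer to \<open>u\<close> than the total mass. Where
  \<open>\<bar>u x\<bar> = 1\<close>, the product \<open>u x * d n x\<close> differs from
  \<open>u x * u x = 1\<close> by \<open>\<bar>d n x - u x\<bar>\<close>, and truncation fixes 1 and
  is 1-Lipschitz. Integrating leaves a positive integral.\<close>

lemma sign_not_orthogonal_to_dense:
  fixes u :: "'a \<Rightarrow> real"
  assumes "finite_measure M" and pos: "measure M (space M) > 0"
    and d: "\<And>n::nat. integrable M (d n)"
      "\<And>w e. integrable M w \<Longrightarrow> e > 0 \<Longrightarrow> \<exists>n. (LINT x|M. \<bar>d n x - w x\<bar>) < e"
    and u: "u \<in> borel_measurable M" "AE x in M. \<bar>u x\<bar> = 1"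
  shows "\<exists>n. (LINT x|M. truncate (u x * d n x)) \<noteq> 0"
proof -
  interpret finite_measure M by fact
  note u(1) [measurable]
  have int_u: "integrable M u"
    using u by (intro integrable_const_bound[where B = 1]) auto
  obtain n where n: "(LINT x|M. \<bar>d n x - u x\<bar>) < measure M (space M)"
    using d(2)[OF int_u pos] by blast
  have [measurable]: "d n \<in> borel_measurable M"
    using d(1) by blast
  have int_t: "integrable M (\<lambda>x. truncate (u x * d n x))"
    by (rule integrable_const_bound[where B = 1]) (auto simp: abs_truncate_le)
  have "measure M (space M) - (LINT x|M. truncate (u x * d n x))
      = (LINT x|M. 1 - truncate (u x * d n x))"
    using int_t by simp
  also have "\<dots> \<le> (LINT x|M. \<bar>d n x - u x\<bar>)"
  proof (rule integral_mono_AE)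
    show "AE x in M. 1 - truncate (u x * d n x) \<le> \<bar>d n x - u x\<bar>"
      using u(2)
    proof eventually_elim
      case (elim x)
      then have "u x = 1 \<or> u x = - 1" by linarith
      then show ?case by (auto simp: truncate_def)
    qed
  qed (use int_t int_u d(1) in auto)
  finally show ?thesis
    using n by (intro exI[of _ n]) linarith
qed

subsection \<open>An admissible quartet without feasible ordinary controls\<close>

text \<open>The even mixture of the Dirac measures at \<open>a\<close> and \<open>b\<close>, written
  as the image of a fair coin so that integrals become two-term averages.\<close>

definition fair_pair :: "'x \<Rightarrow> 'x \<Rightarrow> 'x::topological_space measure" where
  "fair_pair a b = distr (measure_pmf (bernoulli_pmf (1/2))) borel (\<lambda>i. if i then a else b)"

lemma fair_pair_in_borel_probs: "fair_pair a b \<in> borel_probs"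
  by (auto simp: borel_probs_def fair_pair_def intro!: measure_pmf.prob_space_distr)

lemma fair_pair_integral:
  fixes g :: "'x::topological_space \<Rightarrow> real"
  assumes "g \<in> borel_measurable borel"
  shows "integrable (fair_pair a b) g" "(LINT x|fair_pair a b. g x) = (g a + g b) / 2"
proof -
  show "integrable (fair_pair a b) g"
    unfolding fair_pair_def using assms
    by (subst integrable_distr_eq) (auto intro: integrable_measure_pmf_finite)
  show "(LINT x|fair_pair a b. g x) = (g a + g b) / 2"
    unfolding fair_pair_def using assms by (subst integral_distr) auto
qed

lemma measure_fair_pair:
  fixes a b :: "'x::t1_space"
  shows "measure (fair_pair a b) {a, b} = 1"
proof -
  have "(\<lambda>i. if i then a else b) -` {a, b} = UNIV" by auto
  then show ?thesis
    unfolding fair_pair_def by (subst measure_distr) auto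
qed

lemma constant_relaxed_control: "P \<in> borel_probs \<Longrightarrow> (\<lambda>t. P) \<in> relaxed_controls M"
  unfolding relaxed_controls_def borel_of_def
  by (rule measurable_const)
    (simp add: topspace_weak_convergence_topology space_measure_of_conv)

lemma closedin_weak_star_singleton: "closedin weak_star_topology {f}"
proof -
  have "closedin weak_star_topology {g \<in> topspace weak_star_topology. g y \<in> {f y}}" for y
    unfolding weak_star_topology_def
    by (rule closedin_continuous_map_preimage[OF strong_operator_topology_continuous_evaluation]) simp
  then have "closedin weak_star_topology
      (\<Inter>y. {g \<in> topspace weak_star_topology. g y \<in> {f y}})"
    by (intro closedin_Inter) auto
  moreover have "(\<Inter>y. {g \<in> topspace weak_star_topology. g y \<in> {f y}}) = {f}"
    by (auto simp: weak_star_topology_def strong_operator_topology_topspace intro: blinfun_eqI)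
  ultimately show ?thesis by simp
qed

text \<open>Weak-star open sets are norm open, so norm-Borel measurability is the stronger
  property.\<close>

lemma borel_measurable_imp_weak_star_measurable:
  fixes f :: "'a \<Rightarrow> ('e::real_normed_vector \<Rightarrow>\<^sub>L real)"
  assumes "f \<in> borel_measurable M"
  shows "f \<in> measurable M (borel_of weak_star_topology)"
  unfolding borel_of_def
proof (rule measurable_measure_of)
  fix U
  assume "U \<in> {U. openin (weak_star_topology :: ('e \<Rightarrow>\<^sub>L real) topology) U}"
  then have "open U"
    using openin_continuous_map_preimage[OF strong_operator_topology_weaker_than_euclidean, of U]
    by (simp add: weak_star_topology_def)
  then show "f -` U \<inter> space M \<in> sets M"
    by (rule measurable_sets[OF assms borel_open])
qed (auto simp: weak_star_topology_def strong_operator_topology_topspace openin_subset)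

theorem theorem4p2:
  fixes M :: "'t measure"
  assumes "finite_measure M" and "complete_measure M" and "nonatomic M"
    and "\<not> (\<exists>B :: 'e::{banach, second_countable_topology} set. finite B \<and> span B = UNIV)"
    and "compact (UNIV :: 'x::polish_space set)" and "uncountable (UNIV :: 'x set)"
    and "\<forall>(\<phi> :: 't \<Rightarrow> 'x \<Rightarrow> real) (\<Phi> :: 't \<Rightarrow> 'x \<Rightarrow> ('e \<Rightarrow>\<^sub>L real)) U C.
           admissible_quartet M \<phi> \<Phi> U C \<longrightarrow> has_solution M \<phi> \<Phi> U C"
  shows "saturated M"
proof (rule ccontr)
  interpret finite_measure M by fact
  assume "\<not> saturated M"
  then obtain S where S: "S \<in> sets M" "emeasure M S > 0"
    and sep: "separable_space (L1_topology (restrict_space M S))"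
    by (auto simp: saturated_def)
  define N where "N = restrict_space M S"
  interpret N: finite_measure N
    unfolding N_def using S(1) by (intro finite_measure_restrict_space \<open>finite_measure M\<close>) auto
  have S_space: "S \<inter> space M \<in> sets M" "space N = S"
    using S(1) sets.sets_into_space[OF S(1)] by (auto simp: N_def space_restrict_space)
  have pos: "measure N (space N) > 0"
    using S S_space unfolding N_def
    by (subst measure_restrict_space) (auto simp: emeasure_eq_measure)
  obtain d :: "nat \<Rightarrow> 't \<Rightarrow> real" where d: "\<And>n. integrable N (d n)"
    "\<And>w e. integrable N w \<Longrightarrow> e > 0 \<Longrightarrow> \<exists>n. (LINT x|N. \<bar>d n x - w x\<bar>) < e"
    by (rule separable_L1_dense_sequence[OF sep, folded N_def]) (rule that)
  obtain Y :: "nat \<Rightarrow> 'e" and F :: "nat \<Rightarrow> 'e \<Rightarrow>\<^sub>L real"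
    where F: "\<And>n. F n (Y n) \<noteq> 0" "\<And>m n. m < n \<Longrightarrow> F n (Y m) = 0" "\<And>n. norm (F n) \<le> 1"
    by (rule triangular_functionals[OF assms(4)]) (rule that)
  have "\<not> (UNIV :: 'x set) \<subseteq> {a}" for a
    using assms(6) countable_subset[of UNIV "{a}"] by auto
  then obtain a b :: 'x where ab: "a \<noteq> b"
    by blast
  define h where "h x = (dist x a - dist x b) / dist a b" for x
  have h_ab: "h a = - 1" "h b = 1"
    using ab by (simp_all add: h_def dist_commute)
  have h_cont: "continuous_on UNIV h"
    unfolding h_def using ab by (intro continuous_intros) auto
  then have h_meas [measurable]: "h \<in> borel_measurable borel"
    by (rule borel_measurable_continuous_onI)
  \<comment> \<open>Extended by zero off \<open>S\<close>: since \<open>truncate 0 = 0\<close>, the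
    integrand vanishes there and the constraint sees only \<open>S\<close>.\<close>
  define D where "D n t = indicator S t * d n t" for n t
  have D_meas [measurable]: "D n \<in> borel_measurable M" for n
    using d(1)[of n] unfolding N_def D_def
    by (subst (asm) integrable_restrict_space[OF S_space(1)]) auto
  define \<Phi> where "\<Phi> t x = weighted_series F (\<lambda>n. h x * D n t)" for t x
  have \<Phi>_le: "norm (\<Phi> t x) \<le> 2" for t x
    unfolding \<Phi>_def by (rule norm_weighted_series_le[OF F(3)])
  have \<Phi>_meas: "case_prod \<Phi> \<in> borel_measurable (M \<Otimes>\<^sub>M borel)"
    unfolding \<Phi>_def split_beta by (intro weighted_series_measurable[OF F(3)]) measurable
  have \<Phi>_cont: "continuous_on UNIV (\<Phi> t)" for t
    unfolding \<Phi>_def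
    by (intro continuous_on_compose2[OF continuous_on_weighted_series[OF F(3)]]
        continuous_on_coordinatewise_then_product continuous_intros h_cont) auto
  have \<Phi>_app_meas: "(\<lambda>x. \<Phi> t x y) \<in> borel_measurable borel" for t y
    by (intro borel_measurable_continuous_onI continuous_intros \<Phi>_cont)
  \<comment> \<open>\<open>h\<close> takes opposite values at \<open>a\<close> and \<open>b\<close>
    and truncation is odd, so the two vectors cancel in the even mixture.\<close>
  have \<Phi>_ab: "\<Phi> t a = - \<Phi> t b" for t
    using weighted_series_uminus[of F "\<lambda>n. D n t"] F(3) by (simp add: \<Phi>_def h_ab)
  let ?P = "fair_pair a b"
  have "has_gelfand_integral ?P (\<Phi> t) 0" for t
    using fair_pair_integral[OF \<Phi>_app_meas, of a b]
    by (simp add: has_gelfand_integral_def \<Phi>_ab blinfun.minus_left)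
  then have "gelfand_integral ?P (\<Phi> t) = 0" for t
    by (rule gelfand_integral_eq)
  then have relaxed_0: "relaxed_constraint_value M \<Phi> (\<lambda>t. ?P) = 0"
    unfolding relaxed_constraint_value_def
    by (intro gelfand_integral_eq) (simp add: has_gelfand_integral_def)
  have "(\<lambda>t. ?P) \<in> relaxed_feasible M \<Phi> (\<lambda>t. {a, b}) {0}"
    by (simp add: relaxed_feasible_def constant_relaxed_control fair_pair_in_borel_probs
        relaxed_0 measure_fair_pair)
  then have inf: "relaxed_infimum M (\<lambda>t x. 0) \<Phi> (\<lambda>t. {a, b}) {0} < \<infinity>"
    unfolding relaxed_infimum_def by (rule le_less_trans[OF INF_lower]) simp
  have "gph M (\<lambda>t. {a, b}) = space M \<times> {a, b}"
    by (auto simp: gph_def)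
  then have "gph M (\<lambda>t. {a, b}) \<in> sets (M \<Otimes>\<^sub>M borel)"
    by simp
  moreover have "continuous_map euclidean weak_star_topology (\<Phi> t)" for t
    using continuous_map_compose[OF _ strong_operator_topology_weaker_than_euclidean,
        of euclidean "\<Phi> t"] \<Phi>_cont[of t]
    by (simp add: weak_star_topology_def o_def)
  moreover have "integrably_bounded M \<Phi>"
    unfolding integrably_bounded_def using \<Phi>_le by (intro exI[of _ "\<lambda>_. 2"]) auto
  moreover have "integrably_bounded M (\<lambda>t (x::'x). 0::real)"
    unfolding integrably_bounded_def by (intro exI[of _ "\<lambda>_. 0"]) auto
  \<comment> \<open>The feasible relaxed control is constant in \<open>t\<close>, so it also
    witnesses condition (iv).\<close>
  moreover have "{relaxed_constraint_value M \<Phi> (\<lambda>t. P) | P. P \<in> borel_probs} \<inter> {0} \<noteq> {}"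
    using relaxed_0 fair_pair_in_borel_probs by fastforce
  ultimately have quartet: "admissible_quartet M (\<lambda>t x. 0) \<Phi> (\<lambda>t. {a, b}) {0}"
    using inf by (simp add: admissible_quartet_def caratheodory_def closedin_weak_star_singleton
        borel_measurable_imp_weak_star_measurable[OF \<Phi>_meas])
  obtain f where "feasible M \<Phi> (\<lambda>t. {a, b}) {0} f"
    using assms(7)[rule_format, OF quartet] by (auto simp: has_solution_def is_arg_min_def)
  then have f [measurable]: "f \<in> borel_measurable M" and f_ab: "AE t in M. f t \<in> {a, b}"
    and f_0: "gelfand_integral M (\<lambda>t. \<Phi> t (f t)) = 0"
    by (auto simp: feasible_def)
  have "(\<lambda>t. \<Phi> t (f t)) \<in> borel_measurable M"
    using measurable_compose[OF measurable_Pair[OF measurable_ident f] \<Phi>_meas] by simp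
  then have "(\<lambda>t. \<Phi> t (f t) y) \<in> borel_measurable M" for y
    by (rule measurable_compose) (intro borel_measurable_continuous_onI continuous_intros)
  \<comment> \<open>\<open>gelfand_integral\<close> is a definite description; measurability and the
    bound 2 show that it denotes a genuine integral here, so \<open>f_0\<close> yields scalar
    identities.\<close>
  then have "has_gelfand_integral M (\<lambda>t. \<Phi> t (f t)) 0"
    using has_gelfand_integral_gelfand_integral[where \<psi> = "\<lambda>_. 2"] \<Phi>_le f_0 by fastforce
  then have zero: "(LINT t|M. truncate (h (f t) * D n t)) = 0" for n
    unfolding \<Phi>_def
    using F by (intro gelfand_integral_weighted_series_0D[where F = F and Y = Y and
          z = "\<lambda>t n. h (f t) * D n t"] \<open>finite_measure M\<close>) auto
  have "(LINT t|N. truncate (h (f t) * d n t)) = 0" for n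
  proof -
    \<comment> \<open>As \<open>truncate 0 = 0\<close>, the indicator moves out of the truncation
      and the integral over \<open>M\<close> becomes one over \<open>N\<close>.\<close>
    have "indicator S t *\<^sub>R truncate (h (f t) * d n t) = truncate (h (f t) * D n t)" for t
      by (simp add: D_def truncate_def indicator_def)
    then show ?thesis
      using zero[of n] by (simp add: N_def integral_restrict_space[OF S_space(1)])
  qed
  moreover have "\<exists>n. (LINT t|N. truncate (h (f t) * d n t)) \<noteq> 0"
  proof (rule sign_not_orthogonal_to_dense[OF N.finite_measure_axioms pos d])
    show "(\<lambda>t. h (f t)) \<in> borel_measurable N"
      unfolding N_def by (intro measurable_restrict_space1) measurable
    have "AE t in M. \<bar>h (f t)\<bar> = 1"
      using f_ab by eventually_elim (use h_ab in auto)
    then show "AE t in N. \<bar>h (f t)\<bar> = 1"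
      unfolding N_def by (subst AE_restrict_space_iff[OF S_space(1)]) auto
  qed
  ultimately show False by blast
qed

end
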